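(* Let $s$ and $m$ be positive integers with $s$ even, let $k$ be a positive integer with $\frac{k}{2}<m<k$ and $k = 2m+1-i$ for an integer $i$, and let $n = s(2m+1)+1$ or $n = s(2m+1)-1$. Then the power of cycle graph $C_n^k$ is total colorable with $2k+2$ colors. In fact, $\chi''(C_n^k)\le 2k+3$.
   Context: All graphs are finite, simple and undirected. A total coloring of a graph $G$ is a map $f: V(G)\cup E(G)\to C$ ($C$ a set of colors) such that adjacent vertices receive different colors, edges sharing an endpoint receive different colors, and every edge receives a color different from those of its two endpoints. A graph is total colorable with $q$ colors if it has a total coloring with $|C| = q$. The total chromatic number $\chi''(G)$ is the minimum number of colors in a total coloring of $G$. For integers $n,k$ with $1\le k<\lfloor n/2\rfloor$, the power of cycle graph $C_n^k$ has vertex set $\{v_0,\dots,v_{n-1}\}$ and edges $v_j v_{(j+t) \bmod n}$ for all $0\le j\le n-1$ and $1\le t\le k$. It is the Cayley graph of $\mathbb{Z}_n$ with connection set $\{\pm 1,\dots,\pm k\}$. *)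

theory Defs
  imports Complex_Main
begin

text \<open>A graph is given by its vertex set and its set of edges, each edge being the two-element set
  of its endpoints.\<close>

definition simple_graph :: "'a set \<Rightarrow> 'a set set \<Rightarrow> bool" where
  "simple_graph V E \<longleftrightarrow> finite V \<and> (\<forall>e\<in>E. e \<subseteq> V \<and> card e = 2)"

text \<open>The disjoint sum \<open>V <+> E\<close> plays the role of \<open>V \<union> E\<close>.\<close>

definition total_coloring ::
    "'a set \<Rightarrow> 'a set set \<Rightarrow> 'c set \<Rightarrow> ('a + 'a set \<Rightarrow> 'c) \<Rightarrow> bool" where
  "total_coloring V E C f \<longleftrightarrow>
     f ` (V <+> E) \<subseteq> C \<and>
     (\<forall>u\<in>V. \<forall>v\<in>V. {u, v} \<in> E \<longrightarrow> f (Inl u) \<noteq> f (Inl v)) \<and>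
     (\<forall>e\<in>E. \<forall>e'\<in>E. e \<noteq> e' \<and> e \<inter> e' \<noteq> {} \<longrightarrow> f (Inr e) \<noteq> f (Inr e')) \<and>
     (\<forall>e\<in>E. \<forall>v\<in>e. f (Inr e) \<noteq> f (Inl v))"

text \<open>Colors are natural numbers, without loss of generality. The condition \<open>finite C\<close> is needed
  since \<open>card\<close> of an infinite set is 0; not every color of \<open>C\<close> has to be used.\<close>

definition total_colorable :: "'a set \<Rightarrow> 'a set set \<Rightarrow> nat \<Rightarrow> bool" where
  "total_colorable V E q \<longleftrightarrow>
     (\<exists>(C :: nat set) f. finite C \<and> card C = q \<and> total_coloring V E C f)"

definition total_chromatic_number :: "'a set \<Rightarrow> 'a set set \<Rightarrow> nat" where
  "total_chromatic_number V E = (LEAST q. total_colorable V E q)"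

text \<open>The power of cycle graph, the vertex \<open>v\<^sub>j\<close> being the number \<open>j\<close>. It is meant for
  \<open>1 \<le> k < n div 2\<close>.\<close>

definition cycle_power_verts :: "nat \<Rightarrow> nat set" where
  "cycle_power_verts n = {0..<n}"

definition cycle_power_edges :: "nat \<Rightarrow> nat \<Rightarrow> nat set set" where
  "cycle_power_edges n k = {{j, (j + t) mod n} | j t. j < n \<and> 1 \<le> t \<and> t \<le> k}"

lemma simple_graph_cycle_power:
  assumes "k < n div 2"
  shows "simple_graph (cycle_power_verts n) (cycle_power_edges n k)"
proof -
  have "(j + t) mod n \<noteq> j" if "j < n" "1 \<le> t" "t \<le> k" for j t
  proof (cases "j + t < n")
    case False
    then have "(j + t) mod n = j + t - n"
      using that assms by (simp add: le_mod_geq)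
    moreover have "k < n" using assms by simp
    ultimately show ?thesis using that False by linarith
  qed (use that in simp)
  then have "card {j, (j + t) mod n} = 2" if "j < n" "1 \<le> t" "t \<le> k" for j t
    using that by (metis card_2_iff)
  then show ?thesis
    unfolding simple_graph_def cycle_power_verts_def cycle_power_edges_def by auto
qed

text \<open>Coloring all vertices and edges differently shows that the minimum in
  \<open>total_chromatic_number\<close> is attained.\<close>

lemma total_colorable_exists:
  assumes "simple_graph V E"
  shows "\<exists>q. total_colorable V E q"
proof -
  have "E \<subseteq> Pow V" and V: "finite V"
    using assms by (auto simp: simple_graph_def)
  then have "finite (V <+> E)" by (simp add: finite_subset)
  then obtain f :: "'a + 'a set \<Rightarrow> nat" where f: "inj_on f (V <+> E)"
    using finite_imp_inj_to_nat_seg by blast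
  have "total_coloring V E (f ` (V <+> E)) f"
    unfolding total_coloring_def
  proof (intro conjI ballI impI)
    fix u v assume uv: "u \<in> V" "v \<in> V" "{u, v} \<in> E"
    then have "u \<noteq> v" using assms by (auto simp: simple_graph_def)
    then show "f (Inl u) \<noteq> f (Inl v)"
      using uv inj_onD[OF f, of "Inl u" "Inl v"] by auto
  next
    fix e e' assume "e \<in> E" "e' \<in> E" "e \<noteq> e' \<and> e \<inter> e' \<noteq> {}"
    then show "f (Inr e) \<noteq> f (Inr e')"
      using inj_onD[OF f, of "Inr e" "Inr e'"] by auto
  next
    fix e v assume "e \<in> E" "v \<in> e"
    then show "f (Inr e) \<noteq> f (Inl v)"
      using inj_onD[OF f, of "Inr e" "Inl v"] \<open>E \<subseteq> Pow V\<close> by auto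
  qed simp
  then show ?thesis
    unfolding total_colorable_def using \<open>finite (V <+> E)\<close> by blast
qed

end

theory Submission
  imports Defs
begin

text \<open>Put \<open>L = 2m + 1\<close>. If \<open>L\<close> divides \<open>N\<close>, the circulant on \<open>N\<close> vertices with lengths at most \<open>m\<close> is
  totally colored by \<open>L\<close> colors when the edge \<open>ab\<close> gets \<open>a + b\<close> and the vertex \<open>a\<close> gets \<open>2a\<close> modulo
  \<open>L\<close>. As \<open>k < 2m\<close>, these vertex colors stay proper for lengths up to \<open>k\<close> even after deleting or
  inserting one vertex. Such a change can be arranged so that among the edges of length at most \<open>m\<close> only
  a matching \<open>F\<close> of \<open>m\<close> consecutive edges of length \<open>m\<close> (and possibly the new vertex) is left uncolored.

  It remains to color \<open>H \<union> F\<close> with the other \<open>2(k - m) + 1\<close> colors, where \<open>H\<close> consists of the edges of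
  lengths \<open>m + 1, \<dots>, k\<close> and is \<open>2(k - m)\<close>-regular. Vizing's theorem colors \<open>H\<close>. The edges of \<open>F\<close> are
  then added one at a time along the cycle: at the first endpoint of each of them, the Vizing fan meets
  no vertex of an earlier edge of \<open>F\<close>, so every vertex involved still misses a color. An inserted
  vertex is not covered by \<open>F\<close>, so it takes a color missing at it.\<close>

section \<open>Edge colorings, missing colors and degrees\<close>

definition edge_coloring :: "'a set set \<Rightarrow> 'c set \<Rightarrow> ('a set \<Rightarrow> 'c) \<Rightarrow> bool" where
  "edge_coloring E Q c \<longleftrightarrow>
     (\<forall>e\<in>E. c e \<in> Q) \<and> (\<forall>e\<in>E. \<forall>e'\<in>E. e \<noteq> e' \<and> e \<inter> e' \<noteq> {} \<longrightarrow> c e \<noteq> c e')"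

definition missing :: "'a set set \<Rightarrow> 'c set \<Rightarrow> ('a set \<Rightarrow> 'c) \<Rightarrow> 'a \<Rightarrow> 'c set" where
  "missing E Q c v = {\<alpha>\<in>Q. \<forall>e\<in>E. v \<in> e \<longrightarrow> c e \<noteq> \<alpha>}"

definition degree :: "'a set set \<Rightarrow> 'a \<Rightarrow> nat" where
  "degree E v = card {e\<in>E. v \<in> e}"

lemma edge_coloring_subset:
  "edge_coloring E Q c \<Longrightarrow> E' \<subseteq> E \<Longrightarrow> edge_coloring E' Q c"
  unfolding edge_coloring_def by blast

lemma edge_coloring_insert:
  assumes "edge_coloring E Q c" and "\<gamma> \<in> missing E Q c u" and "\<gamma> \<in> missing E Q c v"
  shows "edge_coloring (insert {u, v} E) Q (c({u, v} := \<gamma>))"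
  using assms unfolding edge_coloring_def missing_def by auto

lemma missing_nonempty:
  assumes "finite E" and "degree E v < card Q"
  shows "missing E Q c v \<noteq> {}"
proof
  assume "missing E Q c v = {}"
  then have "Q \<subseteq> c ` {e\<in>E. v \<in> e}" unfolding missing_def by auto
  then have "card Q \<le> card {e\<in>E. v \<in> e}"
    using assms(1) by (simp add: surj_card_le)
  then show False using assms(2) unfolding degree_def by simp
qed

section \<open>Vizing fans\<close>

text \<open>The edge from \<open>u\<close> to \<open>w 0\<close> is the one still to be colored, so
  nothing is asked of it. That \<open>\<mu>\<close> picks missing colors is kept out of the
  definition, because missing colors can change under a Kempe swap that leaves the fan
  intact.\<close>

definition fan :: "'a set set \<Rightarrow> ('a set \<Rightarrow> 'c) \<Rightarrow> 'a \<Rightarrow> ('a \<Rightarrow> 'c) \<Rightarrow> (nat \<Rightarrow> 'a) \<Rightarrow> nat \<Rightarrow> bool" where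
  "fan E c u \<mu> w k \<longleftrightarrow>
     inj_on w {..k} \<and> (\<forall>i<k. {u, w (Suc i)} \<in> E \<and> c {u, w (Suc i)} = \<mu> (w i))"

text \<open>Rotating the fan by one step colors \<open>{u, w 0}\<close> and uncolors \<open>{u, w 1}\<close>, leaving a shorter
  fan.\<close>

lemma fan_shift:
  assumes "edge_coloring E Q c" and "{u, w 0} \<notin> E" and "\<forall>i\<le>k. w i \<noteq> u"
    and "fan E c u \<mu> w k" and "\<forall>i<k. \<mu> (w i) \<in> missing E Q c (w i)"
    and "\<gamma> \<in> missing E Q c u" and "\<gamma> \<in> missing E Q c (w k)"
  shows "\<exists>c'. edge_coloring (insert {u, w 0} E) Q c'"
  using assms
proof (induction k arbitrary: E c w)
  case 0
  then show ?case using edge_coloring_insert[OF 0(1) 0(6) 0(7)] by (intro exI)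
next
  case (Suc k)
  note prems = Suc.prems
  have inj: "inj_on w {..Suc k}"
    and fan: "\<And>i. i < Suc k \<Longrightarrow> {u, w (Suc i)} \<in> E \<and> c {u, w (Suc i)} = \<mu> (w i)"
    using prems(4) unfolding fan_def by auto
  have ne: "w i \<noteq> w j" if "i \<le> Suc k" "j \<le> Suc k" "i \<noteq> j" for i j
    using inj that by (auto dest: inj_onD)
  have e1: "{u, w 1} \<in> E" "c {u, w 1} = \<mu> (w 0)" using fan[of 0] by auto
  define E1 where "E1 = E - {{u, w 1}}"
  define E' where "E' = insert {u, w 0} E1"
  define c' where "c' = c({u, w 0} := \<mu> (w 0))"
  have col1: "edge_coloring E1 Q c"
    using edge_coloring_subset[OF prems(1)] unfolding E1_def by auto
  have \<mu>0: "\<mu> (w 0) \<in> missing E Q c (w 0)" using prems(5) by auto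
  then have m0: "\<mu> (w 0) \<in> missing E1 Q c (w 0)"
    unfolding missing_def E1_def by auto
  \<comment> \<open>Only \<open>{u, w 1}\<close> had the color \<open>\<mu> (w 0)\<close> at
    \<open>u\<close>, so uncoloring it frees this color there.\<close>
  have mu: "\<mu> (w 0) \<in> missing E1 Q c u"
  proof -
    have "c e \<noteq> \<mu> (w 0)" if "e \<in> E1" "u \<in> e" for e
    proof -
      have "e \<in> E" "e \<noteq> {u, w 1}" "e \<inter> {u, w 1} \<noteq> {}" using that unfolding E1_def by auto
      then show ?thesis using prems(1) e1 unfolding edge_coloring_def by metis
    qed
    then show ?thesis using \<mu>0 unfolding missing_def by auto
  qed
  have col': "edge_coloring E' Q c'"
    unfolding E'_def c'_def by (rule edge_coloring_insert[OF col1 mu m0])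
  have agree: "c' e = c e" if "e \<in> E" for e using that prems(2) unfolding c'_def by auto
  have n1: "{u, w 1} \<notin> E'"
    using ne[of 0 1] unfolding E'_def E1_def by (auto simp: doubleton_eq_iff)
  \<comment> \<open>The rotation adds an edge at \<open>u\<close> and \<open>w 0\<close> only; no
    later fan vertex loses a missing color.\<close>
  have far: "missing E Q c (w (Suc i)) \<subseteq> missing E' Q c' (w (Suc i))" if "i \<le> k" for i
    using ne[of "Suc i" 0] that prems(3) agree
    unfolding missing_def E'_def E1_def by auto
  have fan': "fan E' c' u \<mu> (w \<circ> Suc) k"
    unfolding fan_def
  proof (intro conjI allI impI)
    show "inj_on (w \<circ> Suc) {..k}"
      using ne by (auto simp: inj_on_def)
    fix i assume i: "i < k"
    have "{u, w (Suc (Suc i))} \<noteq> {u, w 1}"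
      using ne[of "Suc (Suc i)" 1] i by (auto simp: doubleton_eq_iff)
    then show "{u, (w \<circ> Suc) (Suc i)} \<in> E'"
      using fan[of "Suc i"] i unfolding E'_def E1_def by auto
    show "c' {u, (w \<circ> Suc) (Suc i)} = \<mu> ((w \<circ> Suc) i)"
      using fan[of "Suc i"] i agree by auto
  qed
  have "\<exists>c''. edge_coloring (insert {u, (w \<circ> Suc) 0} E') Q c''"
  proof (rule Suc.IH[OF col' _ _ fan'])
    \<comment> \<open>\<open>\<gamma>\<close> differs from \<open>\<mu> (w 0)\<close>, since the
      latter is present at \<open>u\<close> in the old coloring.\<close>
    show "\<gamma> \<in> missing E' Q c' u"
      using prems(6) e1 prems(2) unfolding missing_def E'_def E1_def c'_def by auto
    show "\<forall>i<k. \<mu> ((w \<circ> Suc) i) \<in> missing E' Q c' ((w \<circ> Suc) i)"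
    proof (intro allI impI)
      fix i assume "i < k"
      then show "\<mu> ((w \<circ> Suc) i) \<in> missing E' Q c' ((w \<circ> Suc) i)"
        using prems(5)[rule_format, of "Suc i"] far[of i] by auto
    qed
    show "\<gamma> \<in> missing E' Q c' ((w \<circ> Suc) k)"
      using prems(7) far by fastforce
  qed (use n1 prems(3) in auto)
  moreover have "insert {u, (w \<circ> Suc) 0} E' = insert {u, w 0} E"
    using e1 unfolding E'_def E1_def by auto
  ultimately show ?case by simp
qed

section \<open>Kempe chains as orbits of two involutions\<close>

text \<open>Starting at \<open>u\<close>, which \<open>b\<close> fixes, the walk that applies
  \<open>a\<close> and \<open>b\<close> in turn runs along a path until it stalls at the other end,
  if ever. Only there can \<open>a\<close> have a further fixed point.\<close>

lemma alternating_orbit: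
  fixes a b :: "'a \<Rightarrow> 'a"
  assumes a: "\<And>v. a (a v) = v" and b: "\<And>v. b (b v) = v" and u: "b u = u"
  obtains K where "u \<in> K" and "\<And>v. v \<in> K \<Longrightarrow> a v \<in> K" and "\<And>v. v \<in> K \<Longrightarrow> b v \<in> K"
    and "\<And>x y. \<lbrakk>x \<in> K; y \<in> K; x \<noteq> u; y \<noteq> u; a x = x; a y = y\<rbrakk> \<Longrightarrow> x = y"
proof -
  define p where "p = rec_nat u (\<lambda>i v. if even i then a v else b v)"
  have p0: "p 0 = u" and pS: "p (Suc i) = (if even i then a (p i) else b (p i))" for i
    unfolding p_def by auto
  have pP: "p i = (if even i then a (p (Suc i)) else b (p (Suc i)))" for i
    using pS[of i] a b by auto
  have ea: "a (p i) = (if even i then p (Suc i) else p (i - 1))" for i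
    using pS[of i] pP[of "i - 1"] by (cases i) auto
  \<comment> \<open>For \<open>i = 0\<close> the truncated \<open>i - 1\<close> is again 0, which
    matches \<open>b u = u\<close>.\<close>
  have eb: "b (p i) = (if odd i then p (Suc i) else p (i - 1))" for i
    using pS[of i] pP[of "i - 1"] u p0 by (cases i) auto
  have key: "x = y"
    if xy: "x \<in> range p" "y \<in> range p" "x \<noteq> u" "y \<noteq> u" "a x = x" "a y = y" for x y
  proof -
    have ex: "\<exists>i. p i = p (Suc i)"
    proof -
      obtain i where "x = p i" using xy(1) by auto
      then have "p i = p (Suc i) \<or> (i > 0 \<and> p i = p (i - 1))"
        using xy(3,5) ea[of i] p0 by (cases i) (auto split: if_splits)
      then show ?thesis by (metis Suc_diff_1)
    qed
    define i where "i = (LEAST i. p i = p (Suc i))"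
    have i: "p i = p (Suc i)" unfolding i_def using ex by (rule LeastI_ex)
    have less: "p l \<noteq> p (Suc l)" if "l < i" for l
      using that not_less_Least unfolding i_def by blast
    have refl: "p (Suc i + t) = p (i - t)" if "t \<le> i" for t
      using that
    proof (induction t)
      case 0 then show ?case using i by simp
    next
      case (Suc t)
      define l where "l = i - Suc t"
      have l: "i - t = Suc l" "i = Suc (l + t)" using Suc.prems unfolding l_def by auto
      have "even (Suc i + t) \<longleftrightarrow> even l" using l by auto
      then show ?case
        using Suc l pS[of "Suc i + t"] pP[of l] unfolding l_def[symmetric] by auto
    qed
    \<comment> \<open>As \<open>p (Suc i) = p i\<close>, the positions up to the first stall are
      closed under both involutions.\<close>
    have "p j \<in> p ` {..i}" for j
    proof (induction j)
      case (Suc j)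
      then obtain l where l: "p j = p l" "l \<le> i" by auto
      have mem: "p (l - 1) \<in> p ` {..i}" "p (Suc l) \<in> p ` {..i}"
      proof -
        show "p (l - 1) \<in> p ` {..i}" using l(2) by auto
        show "p (Suc l) \<in> p ` {..i}"
        proof (cases "l = i")
          case True
          then show ?thesis unfolding True i[symmetric] by auto
        qed (use l(2) in auto)
      qed
      then have nb: "a (p l) \<in> p ` {..i}" "b (p l) \<in> p ` {..i}"
        using ea[of l] eb[of l] by auto
      show ?case using pS[of j] l nb by auto
    qed auto
    then have range: "range p = p ` {..i}" by auto
    \<comment> \<open>Before the stall consecutive positions differ, so a fixed point of
      \<open>a\<close> other than \<open>u\<close> can only sit at index \<open>i\<close>.\<close>
    have last: "z = p i" if z: "z \<in> range p" "z \<noteq> u" "a z = z" for z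
    proof -
      obtain l where l: "z = p l" "l \<le> i" using z(1) range by auto
      have "l \<noteq> 0" using l z(2) p0 by metis
      then have "l - 1 < i" "Suc (l - 1) = l" using l by auto
      then have "p l \<noteq> p (l - 1)" using less[of "l - 1"] by metis
      then have "p l = p (Suc l)" using ea[of l] z(3) l(1) by (auto split: if_splits)
      then have "\<not> l < i" using less[of l] by auto
      then have "l = i" using l(2) by simp
      then show ?thesis using l(1) by simp
    qed
    show ?thesis using last[of x] last[of y] xy by simp
  qed
  show ?thesis
  proof (rule that[of "range p"])
    show "u \<in> range p" using p0 by (metis rangeI)
    show "\<And>v. v \<in> range p \<Longrightarrow> a v \<in> range p" using ea by auto
    show "\<And>v. v \<in> range p \<Longrightarrow> b v \<in> range p" using eb by auto
  qed (use key in blast)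
qed

text \<open>A color class is a matching, so exchanging the ends of its edges is an involution that
  fixes the vertices missing the color. Two such involutions describe a Kempe chain.\<close>

lemma color_class_involution:
  assumes col: "edge_coloring E Q c"
  obtains a where "\<And>v. a (a v) = v"
    and "\<And>v z. {v, z} \<in> E \<Longrightarrow> c {v, z} = \<gamma> \<Longrightarrow> a v = z"
    and "\<And>v. \<gamma> \<in> missing E Q c v \<Longrightarrow> a v = v"
proof -
  define M where "M v z \<longleftrightarrow> {v, z} \<in> E \<and> c {v, z} = \<gamma>" for v z
  define a where "a v = (if \<exists>z. M v z then THE z. M v z else v)" for v
  have sym: "M v z \<Longrightarrow> M z v" for v z unfolding M_def by (simp add: insert_commute)
  have uniq: "z = z'" if "M v z" "M v z'" for v z z'
  proof -
    have "{v, z} \<inter> {v, z'} \<noteq> {}" by auto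
    then have "{v, z} = {v, z'}"
      using that col unfolding M_def edge_coloring_def by metis
    then show ?thesis by (auto simp: doubleton_eq_iff)
  qed
  have aM: "a v = z" if "M v z" for v z
  proof -
    have "(THE z. M v z) = z" using that uniq by (intro the_equality) auto
    then show ?thesis unfolding a_def using that by auto
  qed
  show ?thesis
  proof
    show "a (a v) = v" for v
    proof (cases "\<exists>z. M v z")
      case True
      then obtain z where "M v z" by auto
      then show ?thesis using aM sym by metis
    next
      case False
      then show ?thesis unfolding a_def by auto
    qed
    show "{v, z} \<in> E \<Longrightarrow> c {v, z} = \<gamma> \<Longrightarrow> a v = z" for v z
      using aM unfolding M_def by auto
    show "a v = v" if "\<gamma> \<in> missing E Q c v" for v
    proof -
      have "\<not> M v z" for z using that unfolding M_def missing_def by auto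
      then show ?thesis unfolding a_def by auto
    qed
  qed
qed

text \<open>\<open>K\<close> is the orbit of \<open>u\<close> under the involutions of both colors.
  The chain ends at \<open>u\<close>, which misses \<open>\<alpha>\<close>, so at most one other
  vertex of it misses \<open>\<beta>\<close>.\<close>

lemma kempe_component:
  assumes col: "edge_coloring E Q c" and E2: "\<forall>e\<in>E. card e = 2"
    and u: "\<alpha> \<in> missing E Q c u" and x: "\<beta> \<in> missing E Q c x" and y: "\<beta> \<in> missing E Q c y"
    and "x \<noteq> u" and "y \<noteq> u" and "x \<noteq> y"
  obtains K where "u \<in> K" and "\<not> (x \<in> K \<and> y \<in> K)"
    and "\<forall>e\<in>E. c e \<in> {\<alpha>, \<beta>} \<longrightarrow> e \<inter> K \<noteq> {} \<longrightarrow> e \<subseteq> K"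
proof -
  obtain a where a: "\<And>v. a (a v) = v"
    "\<And>v z. {v, z} \<in> E \<Longrightarrow> c {v, z} = \<beta> \<Longrightarrow> a v = z"
    "\<And>v. \<beta> \<in> missing E Q c v \<Longrightarrow> a v = v"
    using color_class_involution[OF col, where \<gamma> = \<beta>] by metis
  obtain b where b: "\<And>v. b (b v) = v"
    "\<And>v z. {v, z} \<in> E \<Longrightarrow> c {v, z} = \<alpha> \<Longrightarrow> b v = z"
    "\<And>v. \<alpha> \<in> missing E Q c v \<Longrightarrow> b v = v"
    using color_class_involution[OF col, where \<gamma> = \<alpha>] by metis
  obtain K where K: "u \<in> K" "\<And>v. v \<in> K \<Longrightarrow> a v \<in> K" "\<And>v. v \<in> K \<Longrightarrow> b v \<in> K"
    "\<And>x y. \<lbrakk>x \<in> K; y \<in> K; x \<noteq> u; y \<noteq> u; a x = x; a y = y\<rbrakk> \<Longrightarrow> x = y"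
    using alternating_orbit[of a b u] a(1) b(1) b(3)[OF u] by metis
  show ?thesis
  proof
    show "u \<in> K" by fact
    show "\<not> (x \<in> K \<and> y \<in> K)" using K(4) a(3) x y assms(6-8) by blast
    show "\<forall>e\<in>E. c e \<in> {\<alpha>, \<beta>} \<longrightarrow> e \<inter> K \<noteq> {} \<longrightarrow> e \<subseteq> K"
    proof (intro ballI impI)
      fix e assume e: "e \<in> E" "c e \<in> {\<alpha>, \<beta>}" "e \<inter> K \<noteq> {}"
      obtain v z where "e = {v, z}" "v \<in> K"
        using e E2 by (metis card_2_iff disjoint_iff doubleton_eq_iff insertE singletonD)
      then show "e \<subseteq> K" using e K(2,3)[of v] a(2)[of v z] b(2)[of v z] by auto
    qed
  qed
qed

text \<open>The two colors are exchanged everywhere outside \<open>K\<close> instead of on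
  \<open>K\<close>. No edge of these colors leaves \<open>K\<close>, so the coloring stays proper.
  Edges at a vertex of \<open>K\<close> keep their colors; with \<open>u\<close> in \<open>K\<close>
  the fan at \<open>u\<close> survives.\<close>

lemma kempe_swap:
  assumes col: "edge_coloring E Q c" and "\<alpha> \<in> Q" and "\<beta> \<in> Q"
    and closed: "\<forall>e\<in>E. c e \<in> {\<alpha>, \<beta>} \<longrightarrow> e \<inter> K \<noteq> {} \<longrightarrow> e \<subseteq> K"
  obtains c' where "edge_coloring E Q c'"
    and "\<forall>e\<in>E. e \<inter> K \<noteq> {} \<longrightarrow> c' e = c e"
    and "\<forall>v\<in>K. missing E Q c' v = missing E Q c v"
    and "\<forall>v. v \<notin> K \<longrightarrow> \<beta> \<in> missing E Q c v \<longrightarrow> \<alpha> \<in> missing E Q c' v"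
    and "\<forall>v. missing E Q c v - {\<alpha>, \<beta>} \<subseteq> missing E Q c' v"
proof -
  define c' where "c' e =
    (if e \<inter> K \<noteq> {} then c e else if c e = \<alpha> then \<beta> else if c e = \<beta> then \<alpha> else c e)" for e
  show ?thesis
  proof
    show "edge_coloring E Q c'"
      unfolding edge_coloring_def
    proof (intro conjI ballI impI)
      fix e assume "e \<in> E" then show "c' e \<in> Q"
        using col assms(2,3) unfolding edge_coloring_def c'_def by auto
    next
      fix e e' assume e: "e \<in> E" "e' \<in> E" "e \<noteq> e' \<and> e \<inter> e' \<noteq> {}"
      then have "c e \<noteq> c e'" using col unfolding edge_coloring_def by blast
      moreover have "e \<inter> K \<noteq> {} \<longleftrightarrow> e' \<inter> K \<noteq> {}" if "c e \<in> {\<alpha>, \<beta>}" "c e' \<in> {\<alpha>, \<beta>}"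
        using closed[rule_format, OF e(1) that(1)]
          closed[rule_format, OF e(2) that(2)] e(3) by blast
      ultimately show "c' e \<noteq> c' e'" unfolding c'_def by (auto split: if_splits)
    qed
    show "\<forall>e\<in>E. e \<inter> K \<noteq> {} \<longrightarrow> c' e = c e" unfolding c'_def by auto
    show "\<forall>v\<in>K. missing E Q c' v = missing E Q c v"
    proof
      fix v assume "v \<in> K"
      then have "c' e = c e" if "v \<in> e" for e using that unfolding c'_def by auto
      then show "missing E Q c' v = missing E Q c v" unfolding missing_def by auto
    qed
    show "\<forall>v. v \<notin> K \<longrightarrow> \<beta> \<in> missing E Q c v \<longrightarrow> \<alpha> \<in> missing E Q c' v"
    proof (intro allI impI)
      fix v assume v: "v \<notin> K" "\<beta> \<in> missing E Q c v"
      have "c' e \<noteq> \<alpha>" if e: "e \<in> E" "v \<in> e" for e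
      proof -
        have "c e \<noteq> \<beta>" using v(2) e unfolding missing_def by auto
        moreover have "e \<inter> K = {}" if "c e = \<alpha>"
          using closed[rule_format, of e] that e v(1) by auto
        ultimately show ?thesis unfolding c'_def by auto
      qed
      then show "\<alpha> \<in> missing E Q c' v" using assms(2) unfolding missing_def by auto
    qed
    show "\<forall>v. missing E Q c v - {\<alpha>, \<beta>} \<subseteq> missing E Q c' v"
      unfolding missing_def c'_def by auto
  qed
qed

section \<open>Vizing's theorem and its refinement for an ordered matching\<close>

text \<open>Take a longest fan. If the color \<open>\<beta>\<close> missing at its last vertex is
  missing at \<open>u\<close>, rotate the fan. Otherwise the edge of color \<open>\<beta>\<close> at
  \<open>u\<close> ends in the fan, so two fan vertices miss \<open>\<beta>\<close>, and a Kempe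
  swap frees \<open>\<alpha>\<close> at one of them. Missing colors are demanded only at
  \<open>u\<close>, \<open>v\<close> and the neighbours of \<open>u\<close>, which later permits
  full degree elsewhere.\<close>

lemma fan_extension:
  assumes fin: "finite E" and E2: "\<forall>e\<in>E. card e = 2" and col: "edge_coloring E Q c"
    and uv: "{u, v} \<notin> E" "u \<noteq> v"
    and mu: "missing E Q c u \<noteq> {}" and mv: "missing E Q c v \<noteq> {}"
    and mw: "\<And>w. {u, w} \<in> E \<Longrightarrow> missing E Q c w \<noteq> {}"
  shows "\<exists>c'. edge_coloring (insert {u, v} E) Q c'"
proof -
  obtain \<mu> where \<mu>: "\<And>w. missing E Q c w \<noteq> {} \<Longrightarrow> \<mu> w \<in> missing E Q c w"
    using that[of "\<lambda>w. SOME \<gamma>. \<gamma> \<in> missing E Q c w"] some_in_eq by metis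
  define P where "P k \<longleftrightarrow> (\<exists>w. w 0 = v \<and> fan E c u \<mu> w k)" for k
  have P0: "P 0" unfolding P_def fan_def by (auto intro!: exI[of _ "\<lambda>_. v"])
  have finV: "finite (insert v (\<Union>E))"
  proof -
    have "finite e" if "e \<in> E" for e using that E2 by (auto intro: card_ge_0_finite)
    then show ?thesis using fin by auto
  qed
  \<comment> \<open>Fan vertices are distinct and lie in a finite set, so a longest fan
    exists.\<close>
  have bound: "k \<le> card (insert v (\<Union>E))" if "P k" for k
  proof -
    obtain w where w: "w 0 = v" "fan E c u \<mu> w k" using \<open>P k\<close> unfolding P_def by blast
    have "w i \<in> insert v (\<Union>E)" if "i \<le> k" for i
    proof (cases i)
      case (Suc l)
      then have "{u, w (Suc l)} \<in> E" using w(2) that unfolding fan_def by simp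
      then show ?thesis using Suc by auto
    qed (use w(1) in simp)
    then have "w ` {..k} \<subseteq> insert v (\<Union>E)" by auto
    then have "card (w ` {..k}) \<le> card (insert v (\<Union>E))" using finV card_mono by blast
    then show ?thesis using w(2) unfolding fan_def by (simp add: card_image)
  qed
  obtain k where k: "P k" "\<And>k'. P k' \<Longrightarrow> k' \<le> k"
    using Greatest_le_nat[of P] GreatestI_nat[of P 0] P0 bound by metis
  obtain w where w0: "w 0 = v" and fan: "fan E c u \<mu> w k" using k(1) unfolding P_def by auto
  have inj: "inj_on w {..k}"
    and step: "\<And>i. i < k \<Longrightarrow> {u, w (Suc i)} \<in> E \<and> c {u, w (Suc i)} = \<mu> (w i)"
    using fan unfolding fan_def by auto
  have wu: "w i \<noteq> u" if "i \<le> k" for i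
  proof (cases i)
    case (Suc l)
    then have "card {u, w i} = 2" using step[of l] that E2 by auto
    then show ?thesis by auto
  qed (use w0 uv(2) in simp)
  have \<mu>w: "\<mu> (w i) \<in> missing E Q c (w i)" if "i \<le> k" for i
    using that w0 mv mw \<mu> step by (cases i) auto
  have fan_le: "fan E c u \<mu> w j" if "j \<le> k" for j
    using fan that unfolding fan_def by (auto intro: inj_on_subset)
  define \<beta> where "\<beta> = \<mu> (w k)"
  obtain \<alpha> where \<alpha>: "\<alpha> \<in> missing E Q c u" using mu by auto
  have \<beta>k: "\<beta> \<in> missing E Q c (w k)" using \<mu>w unfolding \<beta>_def by auto
  show ?thesis
  proof (cases "\<beta> \<in> missing E Q c u")
    case True
    show ?thesis
      using fan_shift[OF col _ _ fan _ True \<beta>k] uv wu \<mu>w w0 by auto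
  next
    case False
    then obtain e where e: "e \<in> E" "u \<in> e" "c e = \<beta>"
      using \<beta>k unfolding missing_def by auto
    then obtain x where x: "e = {u, x}" using E2
      by (metis card_2_iff doubleton_eq_iff insertE singletonD)
    have "x \<in> w ` {..k}"
    proof (rule ccontr)
      assume nx: "x \<notin> w ` {..k}"
      have "fan E c u \<mu> (w(Suc k := x)) (Suc k)"
        unfolding fan_def
      proof (intro conjI allI impI)
        show "inj_on (w(Suc k := x)) {..Suc k}"
          using inj nx unfolding atMost_Suc by (auto simp: inj_on_def)
        fix i assume "i < Suc k"
        then show "{u, (w(Suc k := x)) (Suc i)} \<in> E"
          "c {u, (w(Suc k := x)) (Suc i)} = \<mu> ((w(Suc k := x)) i)"
          using step[of i] e x unfolding \<beta>_def by (cases "i = k"; auto)+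
      qed
      then have "P (Suc k)" unfolding P_def using w0 by (auto intro!: exI[of _ "w(Suc k := x)"])
      then show False using k(2) by fastforce
    qed
    then obtain l where l: "x = w l" "l \<le> k" by auto
    have "l \<noteq> 0" using l w0 uv x e by auto
    then obtain j where j: "l = Suc j" by (cases l) auto
    have jk: "j < k" and \<mu>j: "\<mu> (w j) = \<beta>" using l j step[of j] x e by auto
    \<comment> \<open>\<open>u\<close> has a single edge of color \<open>\<beta>\<close>. With the
      next fact, the colors chosen before index \<open>k\<close>, other than at \<open>j\<close>,
      survive the swap.\<close>
    have uniq: "\<mu> (w i) \<noteq> \<beta>" if "i < k" "i \<noteq> j" for i
    proof -
      have "w (Suc i) \<noteq> w (Suc j)"
        using inj_onD[OF inj, of "Suc i" "Suc j"] that jk by auto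
      then have "{u, w (Suc i)} \<noteq> {u, w (Suc j)}" by (auto simp: doubleton_eq_iff)
      moreover have "{u, w (Suc i)} \<inter> {u, w (Suc j)} \<noteq> {}" by auto
      ultimately show ?thesis
        using col step[OF that(1)] step[OF jk] \<mu>j unfolding edge_coloring_def by metis
    qed
    have not\<alpha>: "\<mu> (w i) \<noteq> \<alpha>" if "i < k" for i
      using \<alpha> step[OF that] unfolding missing_def by auto
    have wjk: "w j \<noteq> w k" using inj_onD[OF inj, of j k] jk by auto
    have \<beta>j: "\<beta> \<in> missing E Q c (w j)" using \<mu>w[of j] \<mu>j jk by auto
    obtain K where K: "u \<in> K" "\<not> (w j \<in> K \<and> w k \<in> K)"
      "\<forall>e\<in>E. c e \<in> {\<alpha>, \<beta>} \<longrightarrow> e \<inter> K \<noteq> {} \<longrightarrow> e \<subseteq> K"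
      using kempe_component[OF col E2 \<alpha> \<beta>j \<beta>k] wu jk wjk by (metis le_refl less_imp_le)
    have Q: "\<alpha> \<in> Q" "\<beta> \<in> Q" using \<alpha> \<beta>k unfolding missing_def by auto
    obtain c' where c': "edge_coloring E Q c'"
      "\<forall>e\<in>E. e \<inter> K \<noteq> {} \<longrightarrow> c' e = c e"
      "\<forall>v\<in>K. missing E Q c' v = missing E Q c v"
      "\<forall>v. v \<notin> K \<longrightarrow> \<beta> \<in> missing E Q c v \<longrightarrow> \<alpha> \<in> missing E Q c' v"
      "\<forall>v. missing E Q c v - {\<alpha>, \<beta>} \<subseteq> missing E Q c' v"
      by (rule kempe_swap[OF col Q K(3)])
    have \<alpha>': "\<alpha> \<in> missing E Q c' u" using c'(3) K(1) \<alpha> by auto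
    have fan': "fan E c' u \<mu> w i" if "i \<le> k" for i
    proof -
      have "c' {u, w (Suc l)} = c {u, w (Suc l)}" if "l < i" for l
        using c'(2) step[of l] K(1) that \<open>i \<le> k\<close> by auto
      then show ?thesis using fan_le[OF that] unfolding fan_def by auto
    qed
    have keep: "\<mu> (w i) \<in> missing E Q c' (w i)" if "i < k" "i \<noteq> j" for i
    proof -
      have "\<mu> (w i) \<in> missing E Q c (w i) - {\<alpha>, \<beta>}"
        using not\<alpha>[of i] uniq[of i] \<mu>w[of i] that by auto
      then show ?thesis using c'(5) by blast
    qed
    show ?thesis
    proof (cases "w j \<in> K")
      case True
      \<comment> \<open>The chain contains \<open>w j\<close>, where \<open>\<beta>\<close> stays
        missing, so the whole fan can be rotated with \<open>\<alpha>\<close> at its end.\<close>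
      then have "w k \<notin> K" using K(2) by auto
      then have "\<alpha> \<in> missing E Q c' (w k)" using c'(4) \<beta>k by auto
      moreover have "\<mu> (w i) \<in> missing E Q c' (w i)" if "i < k" for i
        using keep[of i] that c'(3) True \<mu>j \<beta>j by (cases "i = j") auto
      ultimately show ?thesis
        using fan_shift[OF c'(1) _ _ fan'[of k] _ \<alpha>'] uv wu w0 by auto
    next
      case False
      \<comment> \<open>Now \<open>\<alpha>\<close> becomes missing at \<open>w j\<close>, and the
        fan is cut off there before rotating.\<close>
      then have "\<alpha> \<in> missing E Q c' (w j)" using c'(4) \<beta>j by auto
      then show ?thesis
        using fan_shift[OF c'(1) _ _ fan'[of j] _ \<alpha>'] keep uv wu w0 jk by auto
    qed
  qed
qed

lemma fan_extension_degree:
  assumes "finite E" and "\<forall>e\<in>E. card e = 2" and "edge_coloring E Q c"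
    and "{u, v} \<notin> E" and "u \<noteq> v" and "degree E u < card Q" and "degree E v < card Q"
    and "\<And>w. {u, w} \<in> E \<Longrightarrow> degree E w < card Q"
  shows "\<exists>c'. edge_coloring (insert {u, v} E) Q c'"
  using fan_extension[OF assms(1-5)] missing_nonempty[OF assms(1)] assms(6-8) by metis

lemma degree_mono: "finite E \<Longrightarrow> E' \<subseteq> E \<Longrightarrow> degree E' v \<le> degree E v"
  unfolding degree_def by (auto intro: card_mono)

theorem vizing:
  assumes "finite E" and "\<forall>e\<in>E. card e = 2" and "\<And>v. degree E v < card Q"
  shows "\<exists>c. edge_coloring E Q c"
  using assms
proof (induction E rule: finite_induct)
  case empty
  then show ?case unfolding edge_coloring_def by auto
next
  case (insert e E)
  have d: "degree E v < card Q" for v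
    using degree_mono[of "insert e E" E v] insert.hyps insert.prems(2)[of v] by fastforce
  obtain c where c: "edge_coloring E Q c" using insert.IH insert.prems d by auto
  obtain u v where uv: "e = {u, v}" "u \<noteq> v" using insert.prems(1) by (metis card_2_iff insertI1)
  show ?case
    using fan_extension_degree[OF insert.hyps(1) _ c _ uv(2)] insert uv d by auto
qed

text \<open>The order of the matching edges guarantees that, when \<open>{x j, y j}\<close> is added, no neighbour of
  the fan centre \<open>x j\<close> has full degree.\<close>

lemma vizing_ordered_matching:
  fixes x y :: "nat \<Rightarrow> 'a"
  assumes "finite E" and "\<forall>e\<in>E. card e = 2" and d: "\<And>v. degree E v < card Q"
    and "\<And>i j. i < M \<Longrightarrow> j < M \<Longrightarrow> x i \<noteq> y j"
    and "inj_on x {..<M}" and "inj_on y {..<M}"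
    and "\<And>j. j < M \<Longrightarrow> {x j, y j} \<notin> E"
    and "\<And>i j. i < j \<Longrightarrow> j < M \<Longrightarrow> {x j, y i} \<notin> E \<and> {x j, x i} \<notin> E"
  shows "\<exists>c. edge_coloring (E \<union> (\<lambda>j. {x j, y j}) ` {..<M}) Q c"
  using assms(4-8)
proof (induction M)
  case 0
  then show ?case using vizing[OF assms(1-3)] by auto
next
  case (Suc M)
  note prems = Suc.prems
  define G where "G N = E \<union> (\<lambda>j. {x j, y j}) ` {..<N}" for N
  have neq: "x i \<noteq> x M" "y i \<noteq> y M" if "i < M" for i
    using inj_onD[OF prems(2), of i M] inj_onD[OF prems(3), of i M] that by auto
  have xy: "x i \<noteq> y j" if "i \<le> M" "j \<le> M" for i j using prems(1) that by auto
  obtain c where c: "edge_coloring (G M) Q c"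
  proof -
    have "\<exists>c. edge_coloring (E \<union> (\<lambda>j. {x j, y j}) ` {..<M}) Q c"
      by (rule Suc.IH) (use prems in \<open>auto intro: inj_on_subset\<close>)
    then show ?thesis using that unfolding G_def by auto
  qed
  have fin: "finite (G M)" unfolding G_def using assms(1) by auto
  have G2: "\<forall>e\<in>G M. card e = 2" unfolding G_def using assms(2) xy by auto
  have new: "{x M, y M} \<notin> G M"
  proof -
    have "{x M, y M} \<noteq> {x j, y j}" if "j < M" for j
      using neq(1)[OF that] xy[of M j] that by (auto simp: doubleton_eq_iff)
    then show ?thesis using prems(4)[of M] unfolding G_def by auto
  qed
  have old: "degree (G M) v < card Q" if "\<And>i. i < M \<Longrightarrow> v \<noteq> x i \<and> v \<noteq> y i" for v
  proof -
    have "{e \<in> G M. v \<in> e} = {e\<in>E. v \<in> e}" unfolding G_def using that by auto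
    then show ?thesis using d unfolding degree_def by auto
  qed
  \<comment> \<open>No earlier matching edge touches \<open>x M\<close>, so an edge there to some
    other \<open>z\<close> lies in \<open>E\<close> and by assumption avoids all earlier matched
    vertices.\<close>
  have nb: "degree (G M) z < card Q" if "{x M, z} \<in> G M" for z
  proof -
    have zE: "{x M, z} \<in> E"
      using that neq xy unfolding G_def by (fastforce simp: doubleton_eq_iff)
    have "z \<noteq> x i \<and> z \<noteq> y i" if "i < M" for i
      using prems(5)[of i M] that zE by auto
    then show ?thesis using old by fastforce
  qed
  have "\<exists>c. edge_coloring (insert {x M, y M} (G M)) Q c"
  proof (rule fan_extension_degree[OF fin G2 c new])
    show "x M \<noteq> y M" using xy by auto
    show "degree (G M) (x M) < card Q"
    proof (rule old)
      show "x M \<noteq> x i \<and> x M \<noteq> y i" if "i < M" for i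
        using neq(1)[OF that] xy[of M i] that by auto
    qed
    show "degree (G M) (y M) < card Q"
    proof (rule old)
      show "y M \<noteq> x i \<and> y M \<noteq> y i" if "i < M" for i
        using neq(2)[OF that] xy[of i M] that by auto
    qed
  qed (fact nb)
  moreover have "insert {x M, y M} (G M) = E \<union> (\<lambda>j. {x j, y j}) ` {..<Suc M}"
    unfolding G_def lessThan_Suc by auto
  ultimately show ?case by simp
qed

section \<open>Powers of cycles\<close>

text \<open>Edges are described by ordinary differences of labels: cyclic length \<open>t\<close>
  means difference \<open>t\<close> or, across the origin, \<open>n - t\<close>. Hence the sets
  \<open>D\<close> below consist of small differences and large ones.\<close>

definition dist_edges :: "nat \<Rightarrow> nat set \<Rightarrow> nat set set" where
  "dist_edges n D = {{a, b} | a b. a < b \<and> b < n \<and> b - a \<in> D}"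

lemma cycle_power_edges_subset:
  assumes "k < n"
  shows "cycle_power_edges n k \<subseteq> dist_edges n ({1..k} \<union> {n - k..<n})"
proof
  fix e assume "e \<in> cycle_power_edges n k"
  then obtain j t where e: "e = {j, (j + t) mod n}" "j < n" "1 \<le> t" "t \<le> k"
    unfolding cycle_power_edges_def by auto
  show "e \<in> dist_edges n ({1..k} \<union> {n - k..<n})"
  proof (cases "j + t < n")
    case True
    then have "e = {j, j + t} \<and> j < j + t \<and> j + t < n \<and> j + t - j \<in> {1..k} \<union> {n - k..<n}"
      using e by auto
    then show ?thesis unfolding dist_edges_def by blast
  next
    case False
    then have "(j + t) mod n = j + t - n" using e assms by (simp add: le_mod_geq)
    then have "e = {j + t - n, j} \<and> j + t - n < j \<and> j < n \<and>
        j - (j + t - n) \<in> {1..k} \<union> {n - k..<n}"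
      using False e assms by auto
    then show ?thesis unfolding dist_edges_def by blast
  qed
qed

lemma dist_edges_neighbour:
  assumes "e \<in> dist_edges n D" and "v \<in> e"
  obtains x where "e = {v, x}" "v < n" "x < n" "(v < x \<and> x - v \<in> D) \<or> (x < v \<and> v - x \<in> D)"
proof -
  obtain a b where ab: "e = {a, b}" "a < b" "b < n" "b - a \<in> D"
    using assms(1) unfolding dist_edges_def by auto
  then consider "v = a" | "v = b" using assms(2) by auto
  then show ?thesis
  proof cases
    case 1 then show ?thesis using that[of b] ab by auto
  next
    case 2 then show ?thesis using that[of a] ab by (auto simp: insert_commute)
  qed
qed

lemma dist_edges_card: "e \<in> dist_edges n D \<Longrightarrow> card e = 2"
  unfolding dist_edges_def by auto

lemma finite_dist_edges: "finite (dist_edges n D)"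
proof (rule finite_subset)
  show "dist_edges n D \<subseteq> Pow {..<n}" unfolding dist_edges_def by auto
qed simp

lemma dist_edges_iff: "a < b \<Longrightarrow> {a, b} \<in> dist_edges n D \<longleftrightarrow> b < n \<and> b - a \<in> D"
  unfolding dist_edges_def by (auto simp: doubleton_eq_iff)

text \<open>Each length gives at most two neighbours of \<open>v\<close>, one on either side;
  \<open>v + n - t\<close> stands for \<open>v - t\<close> without truncated subtraction.\<close>

lemma degree_dist_edges:
  assumes "1 \<le> a" and "k < n"
  shows "degree (dist_edges n ({a..k} \<union> {n - k..n - a})) v \<le> 2 * (k + 1 - a)"
proof -
  let ?D = "{a..k} \<union> {n - k..n - a}"
  let ?A = "(\<lambda>t. (v + t) mod n) ` {a..k}" and ?B = "(\<lambda>t. (v + n - t) mod n) ` {a..k}"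
  have "{e \<in> dist_edges n ?D. v \<in> e} \<subseteq> (\<lambda>x. {v, x}) ` (?A \<union> ?B)"
  proof
    fix e assume "e \<in> {e \<in> dist_edges n ?D. v \<in> e}"
    then obtain x where x: "e = {v, x}" "v < n" "x < n"
      "(v < x \<and> x - v \<in> ?D) \<or> (x < v \<and> v - x \<in> ?D)"
      using dist_edges_neighbour[of e n ?D v] by blast
    then consider "v < x" "x - v \<in> {a..k}" | "v < x" "x - v \<in> {n - k..n - a}"
      | "x < v" "v - x \<in> {a..k}" | "x < v" "v - x \<in> {n - k..n - a}" by blast
    then have "x \<in> ?A \<union> ?B"
    proof cases
      case 1
      have "x = (v + (x - v)) mod n" using 1 x by simp
      then show ?thesis using 1 by blast
    next
      case 2
      have "v + n - (n - (x - v)) = x" using 2 x(2,3) by linarith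
      then have "x = (v + n - (n - (x - v))) mod n" using x by simp
      moreover have "n - (x - v) \<in> {a..k}" using 2 x(2,3) assms by auto
      ultimately show ?thesis by blast
    next
      case 3
      have "v + n - (v - x) = x + n" using 3 x(2,3) by linarith
      then have "x = (v + n - (v - x)) mod n" using x by simp
      then show ?thesis using 3 by blast
    next
      case 4
      have "v + (n - (v - x)) = x + n" using 4 x(2,3) by linarith
      then have "x = (v + (n - (v - x))) mod n" using x by simp
      moreover have "n - (v - x) \<in> {a..k}" using 4 x(2,3) assms by auto
      ultimately show ?thesis by blast
    qed
    then show "e \<in> (\<lambda>x. {v, x}) ` (?A \<union> ?B)" using x(1) by blast
  qed
  then have "degree (dist_edges n ?D) v \<le> card ((\<lambda>x. {v, x}) ` (?A \<union> ?B))"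
    unfolding degree_def by (rule card_mono[rotated]) auto
  also have "\<dots> \<le> card (?A \<union> ?B)" by (rule card_image_le) auto
  also have "\<dots> \<le> card ?A + card ?B" by (rule card_Un_le)
  also have "\<dots> \<le> card {a..k} + card {a..k}" by (intro add_mono card_image_le) auto
  finally show ?thesis by simp
qed

section \<open>Separation of equal residues, and assembling a total coloring\<close>

text \<open>\<open>L\<close> divides both arcs between \<open>x\<close> and \<open>y\<close> on the
  cycle of length \<open>N\<close>, so neither is shorter than \<open>L\<close>. In either order the
  second inequality bounds the arc through the origin.\<close>

lemma multiple_far_apart:
  fixes L N x y :: nat
  assumes "L dvd N" and "x < N" and "y < N" and "x \<noteq> y"
    and "x < y \<Longrightarrow> L dvd y - x" and "y < x \<Longrightarrow> L dvd x - y"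
  shows "(x + L \<le> y \<and> y + L \<le> x + N) \<or> (y + L \<le> x \<and> x + L \<le> y + N)"
proof -
  have *: "a + L \<le> b \<and> b + L \<le> a + N" if "a < b" "b < N" "L dvd b - a" for a b
  proof -
    have "L \<le> b - a" using that by (simp add: dvd_imp_le)
    moreover have "L dvd N - (b - a)" using assms(1) that(3) by (rule dvd_diff_nat)
    then have "L \<le> N - (b - a)" using that by (simp add: dvd_imp_le)
    ultimately show ?thesis using that by linarith
  qed
  show ?thesis using *[of x y] *[of y x] assms by (cases "x < y") auto
qed

lemma equal_sums_far_apart:
  fixes L N x y t :: nat
  assumes "L dvd N" and "x < N" and "y < N" and "x \<noteq> y" and "(t + x) mod L = (t + y) mod L"
  shows "(x + L \<le> y \<and> y + L \<le> x + N) \<or> (y + L \<le> x \<and> x + L \<le> y + N)"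
proof (rule multiple_far_apart[OF assms(1-4)])
  show "x < y \<Longrightarrow> L dvd y - x"
    using assms(5) mod_eq_dvd_iff_nat[of "t + x" "t + y" L] by auto
  show "y < x \<Longrightarrow> L dvd x - y"
    using assms(5) mod_eq_dvd_iff_nat[of "t + y" "t + x" L] by auto
qed

text \<open>As \<open>L\<close> is odd, the factor 2 can be cancelled modulo \<open>L\<close>. This
  serves vertex colors and the edges at an inserted vertex.\<close>

lemma equal_doubles_far_apart:
  fixes L N x y t :: nat
  assumes "L dvd N" and "odd L" and "x < N" and "y < N" and "x \<noteq> y"
    and "(t + 2 * x) mod L = (t + 2 * y) mod L"
  shows "(x + L \<le> y \<and> y + L \<le> x + N) \<or> (y + L \<le> x \<and> x + L \<le> y + N)"
proof (rule multiple_far_apart[OF assms(1,3-5)])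
  have L: "coprime L 2" using assms(2) by simp
  have *: "L dvd b - a" if "a < b" "(t + 2 * b) mod L = (t + 2 * a) mod L" for a b
  proof -
    have "L dvd 2 * (b - a)"
      using that mod_eq_dvd_iff_nat[of "t + 2 * a" "t + 2 * b" L] by (auto simp: diff_mult_distrib2)
    then show ?thesis using L by (simp add: coprime_dvd_mult_right_iff)
  qed
  show "x < y \<Longrightarrow> L dvd y - x" "y < x \<Longrightarrow> L dvd x - y" using * assms(6) by auto
qed

text \<open>\<open>S\<close> and \<open>T\<close> use disjoint palettes, so only conflicts inside a
  palette and with vertices remain. A vertex may take its color from either palette, as an inserted
  vertex does later.\<close>

lemma total_colorable_union:
  fixes c g :: "'a set \<Rightarrow> nat"
  assumes cover: "E \<subseteq> S \<union> T" and "L \<le> q"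
    and S: "edge_coloring S {..<L} c" and T: "edge_coloring T {L..<q} g"
    and p: "\<And>v. v \<in> V \<Longrightarrow> p v < q"
    and adj: "\<And>u v. {u, v} \<in> E \<Longrightarrow> u \<in> V \<Longrightarrow> v \<in> V \<Longrightarrow> p u \<noteq> p v"
    and cS: "\<And>e v. e \<in> S \<Longrightarrow> v \<in> e \<Longrightarrow> c e \<noteq> p v"
    and gT: "\<And>e v. e \<in> T \<Longrightarrow> v \<in> e \<Longrightarrow> g e \<noteq> p v"
  shows "total_colorable V E q"
proof -
  define f where "f = case_sum p (\<lambda>e. if e \<in> S then c e else g e)"
  have "total_coloring V E {..<q} f"
    unfolding total_coloring_def
  proof (intro conjI ballI impI)
    show "f ` (V <+> E) \<subseteq> {..<q}"
      using p S T cover \<open>L \<le> q\<close> unfolding f_def edge_coloring_def by fastforce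
    show "f (Inl u) \<noteq> f (Inl v)" if "u \<in> V" "v \<in> V" "{u, v} \<in> E" for u v
      using adj that unfolding f_def by auto
    show "f (Inr e) \<noteq> f (Inl v)" if "e \<in> E" "v \<in> e" for e v
      using cS gT cover that unfolding f_def by auto
    fix e e' assume e: "e \<in> E" "e' \<in> E" "e \<noteq> e' \<and> e \<inter> e' \<noteq> {}"
    have c: "e \<in> S \<Longrightarrow> c e < L" "e' \<in> S \<Longrightarrow> c e' < L"
      and g: "e \<in> T \<Longrightarrow> L \<le> g e" "e' \<in> T \<Longrightarrow> L \<le> g e'"
      using S T unfolding edge_coloring_def by auto
    have mem: "e \<in> S \<or> e \<in> T" "e' \<in> S \<or> e' \<in> T" using cover e(1,2) by auto
    have "e \<in> S \<Longrightarrow> e' \<in> S \<Longrightarrow> c e \<noteq> c e'"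
      using S e(3) unfolding edge_coloring_def by simp
    moreover have "e \<in> T \<Longrightarrow> e' \<in> T \<Longrightarrow> g e \<noteq> g e'"
      using T e(3) unfolding edge_coloring_def by simp
    ultimately
    show "f (Inr e) \<noteq> f (Inr e')"
      using c g mem unfolding f_def by (cases "e \<in> S"; cases "e' \<in> S") auto
  qed
  then show ?thesis unfolding total_colorable_def by (intro exI[of _ "{..<q}"]) auto
qed

section \<open>Deleting a vertex from the circulant\<close>

text \<open>The circulant on \<open>N\<close> vertices loses its vertex \<open>n\<close>. Edges
  passing over it become shorter by one, and those of length \<open>m + 1\<close> turn into the
  \<open>m\<close> edges of length \<open>m\<close> that \<open>S\<close> omits. They form the
  matching in \<open>T\<close>; \<open>2 * k + 2\<close> is \<open>L\<close> plus the
  \<open>2 * (k - m) + 1\<close> colors for \<open>T\<close>.\<close>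

lemma total_colorable_below_multiple:
  fixes m k n N :: nat
  assumes "m < k" and "k < 2 * m" and "2 * m + 1 dvd N" and "2 * (2 * m + 1) \<le> N" and "N = n + 1"
  shows "total_colorable (cycle_power_verts n) (cycle_power_edges n k) (2 * k + 2)"
proof -
  define L where "L = 2 * m + 1"
  have L: "odd L" "L dvd N" "2 * L \<le> N" using assms unfolding L_def by auto
  have kn: "k < n div 2" "k < n" using assms by auto
  let ?E = "cycle_power_edges n k" and ?V = "cycle_power_verts n"
  let ?DE = "{1..k} \<union> {n - k..<n}"
  define S where "S = dist_edges n ({1..m} \<union> {N - m..<n})"
  define H where "H = dist_edges n ({m + 1..k} \<union> {n - k..n - (m + 1)})"
  define x where "x j = n - m + j" for j
  define T where "T = H \<union> (\<lambda>j. {x j, j}) ` {..<m}"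
  define c where "c e = \<Sum>e mod L" for e
  have E: "?E \<subseteq> dist_edges n ?DE" using cycle_power_edges_subset kn by blast
  \<comment> \<open>The last disjunction says that \<open>v\<close> and \<open>x\<close> are at
    distance at most \<open>m\<close> on the cycle of length \<open>N\<close>.\<close>
  have near: "\<exists>x<n. e = {v, x} \<and> v < n \<and> v \<noteq> x \<and> c e = (v + x) mod L \<and>
      ((v \<le> x + m \<and> x \<le> v + m) \<or> v + N \<le> x + m \<or> x + N \<le> v + m)"
    if "e \<in> S" "v \<in> e" for e v
  proof -
    obtain x where x: "e = {v, x}" "v < n" "x < n"
      "(v < x \<and> x - v \<in> {1..m} \<union> {N - m..<n}) \<or> (x < v \<and> v - x \<in> {1..m} \<union> {N - m..<n})"
      by (rule dist_edges_neighbour[OF \<open>e \<in> S\<close>[unfolded S_def] \<open>v \<in> e\<close>])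
    then show ?thesis unfolding c_def by (intro exI[of _ x]) auto
  qed
  have S: "edge_coloring S {..<L} c"
    unfolding edge_coloring_def
  proof (intro conjI ballI impI)
    fix e assume "e \<in> S" show "c e \<in> {..<L}" unfolding c_def L_def by simp
  next
    fix e e' assume e: "e \<in> S" "e' \<in> S" "e \<noteq> e' \<and> e \<inter> e' \<noteq> {}"
    then obtain v where v: "v \<in> e" "v \<in> e'" by auto
    obtain a where a: "a < n" "v < n" "e = {v, a}" "c e = (v + a) mod L"
      "(v \<le> a + m \<and> a \<le> v + m) \<or> v + N \<le> a + m \<or> a + N \<le> v + m"
      using near[OF e(1) v(1)] by auto
    obtain b where b: "b < n" "e' = {v, b}" "c e' = (v + b) mod L"
      "(v \<le> b + m \<and> b \<le> v + m) \<or> v + N \<le> b + m \<or> b + N \<le> v + m"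
      using near[OF e(2) v(2)] by auto
    show "c e \<noteq> c e'"
    proof
      assume "c e = c e'"
      \<comment> \<open>Edges at \<open>v\<close> of equal color would have other ends at least
        \<open>L\<close> apart, but both ends are within \<open>m\<close> of \<open>v\<close>, and
        \<open>2 * m < L\<close>.\<close>
      then have "(a + L \<le> b \<and> b + L \<le> a + N) \<or> (b + L \<le> a \<and> a + L \<le> b + N)"
        using equal_sums_far_apart[OF L(2), of a b v] a b e(3) assms(5) by auto
      then show False
        using a(1,2,5) b(1,4) assms(4,5) unfolding L_def by linarith
    qed
  qed
  have degH: "degree H v < 2 * (k - m) + 1" for v
    using degree_dist_edges[of "m + 1" k n v] assms(1) kn unfolding H_def by simp
  have card: "card {L..<2 * k + 2} = 2 * (k - m) + 1" using assms(1) unfolding L_def by simp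
  obtain g where g: "edge_coloring T {L..<2 * k + 2} g"
  proof -
    have "\<exists>g. edge_coloring (H \<union> (\<lambda>j. {x j, j}) ` {..<m}) {L..<2 * k + 2} g"
    proof (rule vizing_ordered_matching)
      show "finite H" unfolding H_def by (rule finite_dist_edges)
      show "\<forall>e\<in>H. card e = 2" unfolding H_def by (simp add: dist_edges_card)
      show "degree H v < card {L..<2 * k + 2}" for v using degH card by simp
      show "x i \<noteq> j" if "j < m" for i j using that kn assms unfolding x_def by auto
      show "inj_on x {..<m}" "inj_on (\<lambda>j. j) {..<m}" unfolding x_def by (auto simp: inj_on_def)
      \<comment> \<open>For \<open>i \<le> j\<close> the difference of \<open>x j\<close> and
        \<open>i\<close> is at least \<open>n - m\<close>, a cyclic length of at most
        \<open>m\<close>, which is too short for \<open>H\<close>.\<close>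
      have *: "{x j, i} \<notin> H" if "i \<le> j" "j < m" for i j
        using dist_edges_iff[of i "x j" n] that kn assms
        unfolding H_def x_def by (auto simp: insert_commute)
      show "{x j, j} \<notin> H" if "j < m" for j using * that by auto
      have "{x j, x i} \<notin> H" if "i < j" "j < m" for i j
        using dist_edges_iff[of "x i" "x j" n] that kn assms
        unfolding H_def x_def by (auto simp: insert_commute)
      then show "{x j, i} \<notin> H \<and> {x j, x i} \<notin> H" if "i < j" "j < m" for i j
        using that * by auto
    qed
    then show ?thesis using that unfolding T_def by auto
  qed
  show ?thesis
  proof (rule total_colorable_union[OF _ _ S g, where p = "\<lambda>v. (2 * v) mod L"])
    show "L \<le> 2 * k + 2" using assms(1) unfolding L_def by simp
    show "?E \<subseteq> S \<union> T"
    proof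
      fix e assume "e \<in> ?E"
      then obtain a b where ab: "e = {a, b}" "a < b" "b < n" "b - a \<in> ?DE"
        using E unfolding dist_edges_def by auto
      then consider "b - a \<in> {1..m} \<union> {N - m..<n}"
        | "b - a \<in> {m + 1..k} \<union> {n - k..n - (m + 1)}" | "b - a = n - m"
        using \<open>N = n + 1\<close> by fastforce
      then show "e \<in> S \<union> T"
      proof cases
        case 3
        then have "e = {x a, a} \<and> a < m" using ab kn assms(1) unfolding x_def by auto
        then show ?thesis unfolding T_def by auto
      qed (use ab in \<open>auto simp: S_def T_def H_def dist_edges_iff\<close>)
    qed
    show "(2 * v) mod L < 2 * k + 2" if "v \<in> ?V" for v
    proof -
      have "(2 * v) mod L < L" unfolding L_def by simp
      then show ?thesis using assms(1) unfolding L_def by linarith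
    qed
    show "(2 * u) mod L \<noteq> (2 * v) mod L" if "{u, v} \<in> ?E" for u v
    proof
      assume eq: "(2 * u) mod L = (2 * v) mod L"
      have uv: "{u, v} \<in> dist_edges n ?DE" using that E by auto
      then obtain w where w: "{u, v} = {u, w}" "u < n" "w < n"
        "(u < w \<and> w - u \<in> ?DE) \<or> (w < u \<and> u - w \<in> ?DE)"
        using dist_edges_neighbour[OF uv insertI1] by blast
      then have "w = v" by (auto simp: doubleton_eq_iff)
      \<comment> \<open>Adjacent vertices are at distance at most \<open>k + 1 < L\<close> on the
        cycle of length \<open>N\<close>, so their doubles differ.\<close>
      then have "(u + L \<le> v \<and> v + L \<le> u + N) \<or> (v + L \<le> u \<and> u + L \<le> v + N)"
        using equal_doubles_far_apart[OF L(2,1), of u v 0] eq w assms(5) by auto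
      then show False using w \<open>w = v\<close> assms unfolding L_def by auto
    qed
    show "c e \<noteq> (2 * v) mod L" if "e \<in> S" "v \<in> e" for e v
    proof
      assume eq: "c e = (2 * v) mod L"
      obtain a where a: "a < n" "e = {v, a}" "v < n" "v \<noteq> a" "c e = (v + a) mod L"
        "(v \<le> a + m \<and> a \<le> v + m) \<or> v + N \<le> a + m \<or> a + N \<le> v + m"
        using near[OF \<open>e \<in> S\<close> \<open>v \<in> e\<close>] by auto
      then have "(a + L \<le> v \<and> v + L \<le> a + N) \<or> (v + L \<le> a \<and> a + L \<le> v + N)"
        using equal_sums_far_apart[OF L(2), of a v v] eq assms(5) by (auto simp: mult_2)
      then show False using a assms unfolding L_def by linarith
    qed
    show "g e \<noteq> (2 * v) mod L" if "e \<in> T" "v \<in> e" for e v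
    proof -
      have "(2 * v) mod L < L" unfolding L_def by simp
      then show ?thesis using g that(1) unfolding edge_coloring_def by fastforce
    qed
  qed
qed

section \<open>Inserting a vertex into the circulant\<close>

text \<open>The vertex \<open>N\<close> is inserted into the coloring by sums of the circulant on \<open>N\<close> vertices. An edge
  from \<open>a\<close> to \<open>N\<close> takes over the color of \<open>{a, a + m}\<close>, which leaves the coloring by sums: either it
  joins the long edges, or it crosses the insertion point and now has length \<open>m + 1\<close>.\<close>

lemma total_colorable_above_multiple:
  fixes m k n N :: nat
  assumes "m < k" and "k < 2 * m" and "2 * m + 1 dvd N" and "2 * (2 * m + 1) \<le> N" and "n = N + 1"
  shows "total_colorable (cycle_power_verts n) (cycle_power_edges n k) (2 * k + 2)"
proof -
  define L where "L = 2 * m + 1"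
  have L: "odd L" "L dvd N" "2 * L \<le> N" using assms unfolding L_def by auto
  have kn: "k < n div 2" "k < n" using assms by auto
  let ?E = "cycle_power_edges n k" and ?V = "cycle_power_verts n"
  let ?DE = "{1..k} \<union> {n - k..<n}"
  \<comment> \<open>For \<open>b = N\<close> these are the \<open>m\<close> vertices on either side
    of the new one. Otherwise they are the edges of length at most \<open>m\<close> on
    \<open>n\<close> vertices, except for the matching edges \<open>{a, a + m}\<close> with
    \<open>a < m\<close>, which give their colors away. The \<open>+ 1\<close> in the wrapping case
    accounts for the new vertex.\<close>
  define short where "short a b \<longleftrightarrow>
    (if b = N then a < m \<or> N \<le> a + m
     else (b \<le> a + m \<and> \<not> (b = a + m \<and> a < m)) \<or> a + N + 1 \<le> b + m)" for a b
  define S where "S = {{a, b} | a b. a < b \<and> b \<le> N \<and> short a b}"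
  define H where "H = dist_edges n ({m + 1..k} \<union> {n - k..n - (m + 1)})"
  define T where "T = H \<union> (\<lambda>j. {j, j + m}) ` {..<m}"
  \<comment> \<open>For the edge from \<open>a\<close> to \<open>N\<close> this is
    \<open>a + (a + m)\<close> modulo \<open>L\<close>, because \<open>L\<close> divides
    \<open>N\<close>.\<close>
  define c where "c e = (if N \<in> e then 2 * \<Sum>e + m else \<Sum>e) mod L" for e
  have E: "?E \<subseteq> dist_edges n ?DE" using cycle_power_edges_subset kn by blast
  have cN: "c {v, N} = (2 * N + m + 2 * v) mod L" if "v < N" for v
    using that unfolding c_def by (simp add: algebra_simps)
  have cn: "c {v, x} = (v + x) mod L" if "v < N" "x < N" "v \<noteq> x" for v x
    using that unfolding c_def by simp
  have near: "\<exists>x\<le>N. e = {v, x} \<and> v \<le> N \<and> v \<noteq> x \<and> ((v < x \<and> short v x) \<or> (x < v \<and> short x v))"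
    if "e \<in> S" "v \<in> e" for e v
  proof -
    obtain a b where ab: "e = {a, b}" "a < b" "b \<le> N" "short a b"
      using \<open>e \<in> S\<close> unfolding S_def by auto
    then consider "v = a" | "v = b" using \<open>v \<in> e\<close> by auto
    then show ?thesis
    proof cases
      case 1 then show ?thesis using ab by (intro exI[of _ b]) auto
    next
      case 2 then show ?thesis using ab by (intro exI[of _ a]) auto
    qed
  qed
  have S: "edge_coloring S {..<L} c"
    unfolding edge_coloring_def
  proof (intro conjI ballI impI)
    fix e assume "e \<in> S" show "c e \<in> {..<L}" unfolding c_def L_def by simp
  next
    fix e e' assume e: "e \<in> S" "e' \<in> S" "e \<noteq> e' \<and> e \<inter> e' \<noteq> {}"
    then obtain v where v: "v \<in> e" "v \<in> e'" by auto
    obtain a where a: "a \<le> N" "e = {v, a}" "v \<le> N" "v \<noteq> a"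
      "(v < a \<and> short v a) \<or> (a < v \<and> short a v)"
      using near[OF e(1) v(1)] by auto
    obtain b where b: "b \<le> N" "e' = {v, b}" "v \<noteq> b"
      "(v < b \<and> short v b) \<or> (b < v \<and> short b v)"
      using near[OF e(2) v(2)] by auto
    have ab: "a \<noteq> b" using a b e(3) by auto
    have one: False
      if xy: "x < N" "v < N" "v \<noteq> x" "(v < x \<and> short v x) \<or> (x < v \<and> short x v)"
        "short v N" "c {v, x} = c {v, N}" for x
    proof -
      \<comment> \<open>\<open>z\<close> lies \<open>m\<close> steps after \<open>v\<close> on the
        cycle of length \<open>N\<close>; \<open>{v, N}\<close> has taken over the color of
        \<open>{v, z}\<close>.\<close>
      define z where "z = (if v < m then v + m else v + m - N)"
      have vm: "v < m \<or> N \<le> v + m" using xy(5) unfolding short_def by auto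
      have z: "z < N" using vm xy(2) assms(4) unfolding z_def by auto
      have "(2 * N + m + 2 * v) mod L = (v + z) mod L"
      proof (cases "v < m")
        case True
        obtain q where q: "N = L * q" using L(2) by auto
        have "2 * N + m + 2 * v = (v + z) + L * (2 * q)"
          using True q unfolding z_def by simp
        then show ?thesis by (metis mod_mult_self2)
      next
        case False
        obtain q where q: "N = L * q" using L(2) by auto
        have "2 * N + m + 2 * v = (v + z) + L * (3 * q)"
          using False vm q unfolding z_def by simp
        then show ?thesis by (metis mod_mult_self2)
      qed
      then have eq: "(v + x) mod L = (v + z) mod L" using xy(6) cN[OF xy(2)] cn xy(1-3) by simp
      have sh: "(x = v + m \<longrightarrow> m \<le> v) \<and>
          ((v \<le> x + m \<and> x \<le> v + m) \<or> v + N + 1 \<le> x + m \<or> x + N + 1 \<le> v + m)"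
        using xy(1-4) assms(4) unfolding short_def by auto
      \<comment> \<open>\<open>{v, z}\<close> is not in \<open>S\<close>: it is a matching edge or
        passes over the new vertex with length \<open>m + 1\<close>. Then \<open>x\<close> and
        \<open>z\<close>, both within \<open>m\<close> of \<open>v\<close>, are too close for equal
        sums.\<close>
      have "x \<noteq> z"
      proof (cases "v < m")
        case True
        then show ?thesis using sh unfolding z_def by auto
      next
        case False
        then have "z + N = v + m" using vm unfolding z_def by auto
        then show ?thesis using sh[THEN conjunct2] xy(1,2) assms(4) by auto
      qed
      then have far: "(x + L \<le> z \<and> z + L \<le> x + N) \<or> (z + L \<le> x \<and> x + L \<le> z + N)"
        by (rule equal_sums_far_apart[OF L(2) xy(1) z _ eq])
      show False
      proof (cases "v < m")
        case True
        then have "z = v + m" unfolding z_def by auto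
        then show ?thesis using far sh[THEN conjunct2] True xy(1,2) assms(4) unfolding L_def by linarith
      next
        case False
        then have "z + N = v + m" using vm unfolding z_def by auto
        then show ?thesis using far sh[THEN conjunct2] xy(1,2) assms(4) unfolding L_def by linarith
      qed
    qed
    consider "v = N" "a < N" "b < N" | "v < N" "a = N" "b < N" | "v < N" "a < N" "b = N"
      | "v < N" "a < N" "b < N"
      using a(1,3,4) b(1,3) ab by (cases "v = N"; cases "a = N"; cases "b = N") auto
    then show "c e \<noteq> c e'"
    proof cases
      case 1
      show ?thesis
      proof
        assume "c e = c e'"
        then have eq: "(2 * N + m + 2 * a) mod L = (2 * N + m + 2 * b) mod L"
          using cN[OF 1(2)] cN[OF 1(3)] a(2) b(2) 1(1) by (simp add: insert_commute)
        \<comment> \<open>\<open>a\<close> and \<open>b\<close> are among the \<open>2 * m\<close>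
          vertices around the insertion point, so they are less than \<open>L\<close> apart.\<close>
        have "(a + L \<le> b \<and> b + L \<le> a + N) \<or> (b + L \<le> a \<and> a + L \<le> b + N)"
          by (rule equal_doubles_far_apart[OF L(2,1) 1(2,3) ab eq])
        then show False using a(5) b(4) 1 unfolding short_def L_def by auto
      qed
    next
      case 2
      then show ?thesis using one[of b] a b by auto
    next
      case 3
      then show ?thesis using one[of a] a b by auto
    next
      case 4
      show ?thesis
      proof
        assume "c e = c e'"
        then have eq: "(v + a) mod L = (v + b) mod L" using cn 4 a b by auto
        have sh: "(v \<le> a + m \<and> a \<le> v + m) \<or> v + N \<le> a + m \<or> a + N \<le> v + m"
          "(v \<le> b + m \<and> b \<le> v + m) \<or> v + N \<le> b + m \<or> b + N \<le> v + m"
          using a(5) b(4) 4 unfolding short_def by auto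
        have "(a + L \<le> b \<and> b + L \<le> a + N) \<or> (b + L \<le> a \<and> a + L \<le> b + N)"
          by (rule equal_sums_far_apart[OF L(2) 4(2,3) ab eq])
        then show False using sh 4 assms(4) unfolding L_def by linarith
      qed
    qed
  qed
  have degH: "degree H v < 2 * (k - m) + 1" for v
    using degree_dist_edges[of "m + 1" k n v] assms(1) kn unfolding H_def by simp
  have finH: "finite H" unfolding H_def by (rule finite_dist_edges)
  have card: "card {L..<2 * k + 2} = 2 * (k - m) + 1" using assms(1) unfolding L_def by simp
  obtain g where g: "edge_coloring T {L..<2 * k + 2} g"
  proof -
    have "\<exists>g. edge_coloring (H \<union> (\<lambda>j. {j, j + m}) ` {..<m}) {L..<2 * k + 2} g"
    proof (rule vizing_ordered_matching)
      show "finite H" by fact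
      show "\<forall>e\<in>H. card e = 2" unfolding H_def by (simp add: dist_edges_card)
      show "degree H v < card {L..<2 * k + 2}" for v using degH card by simp
      show "i \<noteq> j + m" if "i < m" for i j using that by simp
      show "inj_on (\<lambda>j. j) {..<m}" "inj_on (\<lambda>j. j + m) {..<m}" by (auto simp: inj_on_def)
      \<comment> \<open>The fan centres are the lower ends \<open>j\<close>; the earlier vertices
        \<open>i\<close> and \<open>i + m\<close> are at most \<open>m\<close> away, hence no
        neighbours in \<open>H\<close>.\<close>
      have *: "{j, i + m} \<notin> H" if "i \<le> j" "j < m" for i j
      proof -
        have "i + m - j \<le> m" "m < n - k" "j < i + m" using that assms(1,2,4,5) by auto
        then show ?thesis unfolding H_def by (simp add: dist_edges_iff)
      qed
      show "{j, j + m} \<notin> H" if "j < m" for j using * that by auto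
      have "{j, i} \<notin> H" if "i < j" "j < m" for i j
      proof -
        have "j - i \<le> m" "m < n - k" using that assms(1,2,4,5) by auto
        then have "{i, j} \<notin> H" using that(1) unfolding H_def by (simp add: dist_edges_iff)
        then show ?thesis by (simp add: insert_commute)
      qed
      then show "{j, i + m} \<notin> H \<and> {j, i} \<notin> H" if "i < j" "j < m" for i j
        using that * by auto
    qed
    then show ?thesis using that unfolding T_def by auto
  qed
  \<comment> \<open>The matching stays below \<open>2 * m < N\<close>, so at \<open>N\<close> only
    edges of \<open>H\<close> count and one of the \<open>2 * (k - m) + 1\<close> colors is missing
    there.\<close>
  have "N \<noteq> j \<and> N \<noteq> j + m" if "j < m" for j using that assms(4) by auto
  then have "{e \<in> T. N \<in> e} = {e \<in> H. N \<in> e}" unfolding T_def by auto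
  then have "degree T N < card {L..<2 * k + 2}" using degH[of N] card unfolding degree_def by simp
  moreover have "finite T" using finH unfolding T_def by auto
  ultimately have "missing T {L..<2 * k + 2} g N \<noteq> {}" by (intro missing_nonempty)
  then obtain \<gamma> where \<gamma>: "\<gamma> \<in> missing T {L..<2 * k + 2} g N" by auto
  \<comment> \<open>The color \<open>\<gamma>\<close> is at least \<open>L\<close>, so it clashes
    with no other vertex and no edge of \<open>S\<close>.\<close>
  define p where "p v = (if v = N then \<gamma> else (2 * v) mod L)" for v
  have \<gamma>L: "L \<le> \<gamma>" "\<gamma> < 2 * k + 2" using \<gamma> unfolding missing_def by auto
  have pL: "(2 * v) mod L < L" for v unfolding L_def by simp
  have L2k: "L \<le> 2 * k + 2" using assms(1) unfolding L_def by simp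
  show ?thesis
  proof (rule total_colorable_union[OF _ L2k S g, where p = p])
    show "?E \<subseteq> S \<union> T"
    proof
      fix e assume "e \<in> ?E"
      then obtain a b where ab: "e = {a, b}" "a < b" "b < n" "b - a \<in> ?DE"
        using E unfolding dist_edges_def by auto
      have bN: "b \<le> N" using ab assms(5) by simp
      consider "b - a \<in> {m + 1..k} \<union> {n - k..n - (m + 1)}" | "b = a + m" "a < m"
        | "short a b"
      proof (cases "b - a \<le> m \<or> n - m \<le> b - a")
        case True
        then have "b \<le> a + m \<or> a + N + 1 \<le> b + m" using assms(5) by linarith
        then show ?thesis using that(2,3) bN unfolding short_def by (cases "b = N") auto
      next
        case False
        then have "b - a \<in> {m + 1..k} \<union> {n - k..n - (m + 1)}" using ab(4) by auto
        then show ?thesis by (rule that(1))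
      qed
      then show "e \<in> S \<union> T"
      proof cases
        case 1 then show ?thesis using ab by (auto simp: T_def H_def dist_edges_iff)
      next
        case 2
        then have "e = {a, a + m}" using ab by auto
        then show ?thesis using 2 unfolding T_def by auto
      next
        case 3 then show ?thesis using ab assms(5) unfolding S_def by auto
      qed
    qed
    show "p v < 2 * k + 2" if "v \<in> ?V" for v
      using \<gamma>L(2) pL[of v] L2k unfolding p_def by auto
    show "p u \<noteq> p v" if "{u, v} \<in> ?E" for u v
    proof
      assume eq: "p u = p v"
      have uv: "{u, v} \<in> dist_edges n ?DE" using that E by auto
      then obtain w where w: "{u, v} = {u, w}" "u < n" "w < n"
        "(u < w \<and> w - u \<in> ?DE) \<or> (w < u \<and> u - w \<in> ?DE)"
        using dist_edges_neighbour[OF uv insertI1] by blast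
      then have wv: "w = v" by (auto simp: doubleton_eq_iff)
      have uvN: "u < N" "v < N" "u \<noteq> v"
      proof -
        show ne: "u \<noteq> v" using w(4) wv by auto
        have "u \<noteq> N" "v \<noteq> N"
          using eq ne leD[OF \<gamma>L(1)] pL[of u] pL[of v] unfolding p_def by (auto split: if_splits)
        then show "u < N" "v < N" using w(2,3) wv assms(5) by auto
      qed
      \<comment> \<open>Leaving out \<open>N\<close> does not increase distances, so
        \<open>u\<close> and \<open>v\<close> are within \<open>k < L\<close> and get different
        doubles.\<close>
      then have "(u + L \<le> v \<and> v + L \<le> u + N) \<or> (v + L \<le> u \<and> u + L \<le> v + N)"
        using equal_doubles_far_apart[OF L(2,1), of u v 0] eq unfolding p_def by auto
      then show False using w wv assms unfolding L_def by auto
    qed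
    show "c e \<noteq> p v" if "e \<in> S" "v \<in> e" for e v
    proof
      assume eq: "c e = p v"
      have "c e < L" unfolding c_def L_def by simp
      then have vN: "v \<noteq> N" using eq \<gamma>L(1) unfolding p_def by auto
      obtain a where a: "a \<le> N" "e = {v, a}" "v \<le> N" "v \<noteq> a"
        "(v < a \<and> short v a) \<or> (a < v \<and> short a v)"
        using near[OF \<open>e \<in> S\<close> \<open>v \<in> e\<close>] by auto
      show False
      proof (cases "a = N")
        case True
        then have "(2 * v + (2 * N + m)) mod L = (2 * v) mod L"
          using eq a vN cN[of v] unfolding p_def by (simp add: algebra_simps)
        \<comment> \<open>Equality would force \<open>L dvd m\<close>, impossible for
          \<open>0 < m < L\<close>.\<close>
        then have "L dvd 2 * N + m" using mod_eq_dvd_iff_nat[of "2 * v" "2 * v + (2 * N + m)" L] by auto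
        then have "L dvd m" using L(2) by (simp add: dvd_add_right_iff)
        then show False using dvd_imp_le[of L m] assms(1,2) unfolding L_def by simp
      next
        case False
        then have aN: "a < N" "v < N" using a vN by auto
        then have "(v + a) mod L = (v + v) mod L"
          using eq cn[of v a] a vN unfolding p_def by (simp add: mult_2)
        then have "(a + L \<le> v \<and> v + L \<le> a + N) \<or> (v + L \<le> a \<and> a + L \<le> v + N)"
          using equal_sums_far_apart[OF L(2) aN] a(4) by auto
        then show False using a(5) aN assms(1,2) unfolding short_def L_def by auto
      qed
    qed
    show "g e \<noteq> p v" if "e \<in> T" "v \<in> e" for e v
    proof (cases "v = N")
      case True
      then show ?thesis using \<gamma> that unfolding missing_def p_def by auto
    next
      case False
      then show ?thesis using pL[of v] g that(1) unfolding edge_coloring_def p_def by fastforce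
    qed
  qed
qed

theorem theorem2p3:
  fixes s m k n :: nat and i :: int
  assumes "s > 0" and "m > 0" and "even s" and "k > 0"
    and "real k / 2 < real m" and "m < k"
    and "int k = 2 * int m + 1 - i"
    and "n = s * (2 * m + 1) + 1 \<or> n = s * (2 * m + 1) - 1"
  shows "total_colorable (cycle_power_verts n) (cycle_power_edges n k) (2 * k + 2)
    \<and> total_chromatic_number (cycle_power_verts n) (cycle_power_edges n k) \<le> 2 * k + 3"
proof -
  have k: "k < 2 * m" using assms(5) by linarith
  \<comment> \<open>A positive even \<open>s\<close> is at least 2, so \<open>n\<close> is at least
    \<open>4 * m + 1\<close> and \<open>k < n div 2\<close>, the range for which the graph is
    meant.\<close>
  have "2 \<le> s" using assms(1,3) by presburger
  then have N: "2 * (2 * m + 1) \<le> s * (2 * m + 1)" by (rule mult_le_mono1)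
  have col: "total_colorable (cycle_power_verts n) (cycle_power_edges n k) (2 * k + 2)"
    using assms(8)
  proof
    assume "n = s * (2 * m + 1) + 1"
    then show ?thesis
      using total_colorable_above_multiple[OF assms(6) k _ N] dvd_triv_right by blast
  next
    assume "n = s * (2 * m + 1) - 1"
    then have "s * (2 * m + 1) = n + 1" using N by simp
    then show ?thesis
      using total_colorable_below_multiple[OF assms(6) k _ N] by (metis dvd_triv_right)
  qed
  then have "total_chromatic_number (cycle_power_verts n) (cycle_power_edges n k) \<le> 2 * k + 2"
    unfolding total_chromatic_number_def by (rule Least_le)
  with col show ?thesis by simp
qed

end
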